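(* Let $L$ be a non-trivial group and $S_L$ a finite symmetric generating set of $L$. The complete growth series of the wreath product $G=L\wr\mathbb{Z}$ with respect to the standard generating set $S_L\sqcup\{t^{\pm1}\}$ is not $\mathbb{N}G$-rational.
   Context: $L\wr\mathbb{Z}=\big(\bigoplus_{\mathbb{Z}}L\big)\rtimes\mathbb{Z}$ is the restricted wreath product, with $\mathbb{Z}$ acting by shifts; $t$ is the standard generator of $\mathbb{Z}$, and $S_L\subset L$ is viewed in the copy of $L$ at position $0$. For a group $G$ with finite symmetric generating set $S$, $\|g\|_S$ denotes the word length of $g\in G$. $\mathbb{N}G$ is the group semiring (finite formal sums of elements of $G$ with coefficients in $\mathbb{N}=\{0,1,2,\dots\}$), and $\mathbb{N}G[[s]]$ is the semiring of formal power series over it, the variable $s$ commuting with coefficients. The complete growth series of $(G,S)$ is $\sum_{n\ge 0}\big(\sum_{\|g\|_S=n} g\big)s^n\in\mathbb{N}G[[s]]$. A series in $\mathbb{N}G[[s]]$ is proper if its constant coefficient is $0$. A proper linear system over $\mathbb{N}G[s]$ is a finite system of equations $X_i=P_i(X_1,\dots,X_n)$, $i=1,\dots,n$, where each $P_i$ is a finite sum of monomials of the form $r\cdot s^k$ or $rX_j\cdot s^k$ with $r\in\mathbb{N}G$, $1\le j\le n$ and $k\ge 1$; such a system has a unique solution $(F_1,\dots,F_n)$ consisting of proper series. A series $F=\sum_{n\ge0}a_ns^n\in\mathbb{N}G[[s]]$ is $\mathbb{N}G$-rational if $\sum_{n\ge1}a_ns^n$ is the first component of the proper solution of some proper linear system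 over $\mathbb{N}G[s]$. *)

theory Defs
  imports "HOL-Library.Poly_Mapping" "HOL-Computational_Algebra.Formal_Power_Series"
begin

text \<open>
  Groups are types of class \<^class>\<open>group_add\<close>. This class is written additively but is not
  commutative, so the product $gh$ is \<open>g + h\<close>, the neutral element is \<open>0\<close> and $g^{-1}$ is \<open>- g\<close>.
\<close>

definition subgroup_add :: "'g::group_add set \<Rightarrow> bool" where
  "subgroup_add H \<longleftrightarrow> 0 \<in> H \<and> (\<forall>x\<in>H. \<forall>y\<in>H. x + y \<in> H) \<and> (\<forall>x\<in>H. - x \<in> H)"

definition generates :: "'g::group_add set \<Rightarrow> bool" where
  "generates S \<longleftrightarrow> subgroup_add hull S = UNIV"

definition symmetric :: "'g::group_add set \<Rightarrow> bool" where
  "symmetric S \<longleftrightarrow> (\<forall>x\<in>S. - x \<in> S)"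

text \<open>Meaningful only if \<open>S\<close> is symmetric and generating, as \<open>LEAST\<close> is otherwise over a
  possibly empty set.\<close>

definition word_length :: "'g::group_add set \<Rightarrow> 'g \<Rightarrow> nat" where
  "word_length S g = (LEAST n. \<exists>ws. set ws \<subseteq> S \<and> length ws = n \<and> sum_list ws = g)"


text \<open>
  The group semiring: finitely supported functions with the convolution product
  \<open>single g a * single h b = single (g + h) (a * b)\<close> of \<^theory>\<open>HOL-Library.Poly_Mapping\<close>.
\<close>

type_synonym 'g group_semiring = "'g \<Rightarrow>\<^sub>0 nat"

text \<open>The spheres summed over are finite when \<open>S\<close> is finite, symmetric and generating.\<close>

definition complete_growth_series :: "'g::group_add set \<Rightarrow> 'g group_semiring fps" where
  "complete_growth_series S =
     Abs_fps (\<lambda>n. \<Sum>g | word_length S g = n. Poly_Mapping.single g 1)"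


text \<open>\<open>Const r k\<close> is $r\,s^k$ and \<open>Lin r j k\<close> is $r X_j s^k$. The right-hand side of an equation is
  the sum of a list of these, and the unknowns of a system of size \<open>n\<close> are indexed by \<open>{1..n}\<close>.\<close>

datatype 'r lin_monomial = Const 'r nat | Lin 'r nat nat

fun proper_monomial :: "nat \<Rightarrow> 'r lin_monomial \<Rightarrow> bool" where
  "proper_monomial n (Const r k) \<longleftrightarrow> 1 \<le> k"
| "proper_monomial n (Lin r j k) \<longleftrightarrow> 1 \<le> j \<and> j \<le> n \<and> 1 \<le> k"

fun eval_monomial :: "(nat \<Rightarrow> 'r::semiring_1 fps) \<Rightarrow> 'r lin_monomial \<Rightarrow> 'r fps" where
  "eval_monomial X (Const r k) = fps_const r * fps_X ^ k"
| "eval_monomial X (Lin r j k) = fps_const r * X j * fps_X ^ k"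

definition proper_linear_system :: "nat \<Rightarrow> (nat \<Rightarrow> 'r lin_monomial list) \<Rightarrow> bool" where
  "proper_linear_system n P \<longleftrightarrow> (\<forall>i\<in>{1..n}. \<forall>m\<in>set (P i). proper_monomial n m)"

definition proper_series :: "'r::zero fps \<Rightarrow> bool" where
  "proper_series F \<longleftrightarrow> fps_nth F 0 = 0"

definition proper_solution ::
    "nat \<Rightarrow> (nat \<Rightarrow> 'r::semiring_1 lin_monomial list) \<Rightarrow> (nat \<Rightarrow> 'r fps) \<Rightarrow> bool" where
  "proper_solution n P X \<longleftrightarrow>
     (\<forall>i\<in>{1..n}. proper_series (X i) \<and> X i = (\<Sum>m\<leftarrow>P i. eval_monomial X m))"

definition rational_series :: "'r::semiring_1 fps \<Rightarrow> bool" where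
  "rational_series F \<longleftrightarrow>
     (\<exists>n P X. 1 \<le> n \<and> proper_linear_system n P \<and> proper_solution n P X \<and>
        X 1 = Abs_fps (\<lambda>k. if k = 0 then 0 else fps_nth F k))"

lemma eval_monomial_nth_cong:
  assumes "proper_monomial n m"
    and "\<And>j l. j \<in> {1..n} \<Longrightarrow> l < k \<Longrightarrow> fps_nth (X j) l = fps_nth (Y j) l"
  shows "fps_nth (eval_monomial X m) k = fps_nth (eval_monomial Y m) k"
  using assms by (cases m) (auto simp: fps_X_power_mult_right_nth)

lemma proper_solution_unique:
  assumes P: "proper_linear_system n P"
    and X: "proper_solution n P X" and Y: "proper_solution n P Y"
    and i: "i \<in> {1..n}"
  shows "X i = Y i"
proof -
  have "\<forall>j\<in>{1..n}. fps_nth (X j) k = fps_nth (Y j) k" for k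
  proof (induction k rule: less_induct)
    case (less k)
    show ?case
    proof
      fix j assume j: "j \<in> {1..n}"
      have nth_sum: "fps_nth (\<Sum>m\<leftarrow>ms. eval_monomial Z m) k
          = (\<Sum>m\<leftarrow>ms. fps_nth (eval_monomial Z m) k)" for Z :: "nat \<Rightarrow> 'a fps" and ms
        by (induction ms) auto
      have "map (\<lambda>m. fps_nth (eval_monomial X m) k) (P j)
          = map (\<lambda>m. fps_nth (eval_monomial Y m) k) (P j)"
        using P j less.IH
        by (intro map_cong refl eval_monomial_nth_cong[of n])
           (auto simp: proper_linear_system_def)
      then have "fps_nth (\<Sum>m\<leftarrow>P j. eval_monomial X m) k
          = fps_nth (\<Sum>m\<leftarrow>P j. eval_monomial Y m) k"
        by (simp only: nth_sum)
      moreover have "X j = (\<Sum>m\<leftarrow>P j. eval_monomial X m)"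
        and "Y j = (\<Sum>m\<leftarrow>P j. eval_monomial Y m)"
        using X Y j by (simp_all add: proper_solution_def)
      ultimately show "fps_nth (X j) k = fps_nth (Y j) k"
        by metis
    qed
  qed
  then show ?thesis
    using i by (simp add: fps_eq_iff)
qed


text \<open>
  The restricted wreath product with the infinite cyclic group. \<open>Wreath f m\<close> is $f\,t^m$, where
  \<open>f\<close> is a finitely supported function on the integers; \<open>m\<close> acts on the base group by
  \<open>(shift m f) i = f (i - m)\<close>.
\<close>

declare [[typedef_overloaded]]

datatype 'l wreath = Wreath "int \<Rightarrow>\<^sub>0 'l::zero" int

definition shift :: "int \<Rightarrow> (int \<Rightarrow>\<^sub>0 'l::zero) \<Rightarrow> (int \<Rightarrow>\<^sub>0 'l)" where
  "shift m = Poly_Mapping.map_key (\<lambda>i. i - m)"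

lemma lookup_shift [simp]: "Poly_Mapping.lookup (shift m f) i = Poly_Mapping.lookup f (i - m)"
  by (simp add: shift_def Poly_Mapping.map_key.rep_eq inj_def)

instantiation wreath :: (group_add) group_add
begin

definition zero_wreath :: "'a wreath" where
  "0 = Wreath 0 0"

fun plus_wreath :: "'a wreath \<Rightarrow> 'a wreath \<Rightarrow> 'a wreath" where
  "Wreath f m + Wreath g n = Wreath (f + shift m g) (m + n)"

fun uminus_wreath :: "'a wreath \<Rightarrow> 'a wreath" where
  "- Wreath f m = Wreath (shift (- m) (Poly_Mapping.map uminus f)) (- m)"

definition minus_wreath :: "'a wreath \<Rightarrow> 'a wreath \<Rightarrow> 'a wreath" where
  "x - y = x + - (y :: 'a wreath)"

instance
proof
  fix a b c :: "'a wreath"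
  show "a + b + c = a + (b + c)"
    by (cases a; cases b; cases c)
       (auto intro!: poly_mapping_eqI simp: lookup_add add.assoc algebra_simps diff_diff_eq)
  show "0 + a = a" and "a + 0 = a"
    by (cases a; auto intro!: poly_mapping_eqI simp: zero_wreath_def lookup_add)+
  show "- a + a = 0"
    by (cases a)
       (auto intro!: poly_mapping_eqI simp: zero_wreath_def lookup_add Poly_Mapping.map.rep_eq when_def)
  show "a + - b = a - b"
    by (simp add: minus_wreath_def)
qed

end

definition wreath_base :: "'l::group_add \<Rightarrow> 'l wreath" where
  "wreath_base x = Wreath (Poly_Mapping.single 0 x) 0"

definition wreath_t :: "'l::group_add wreath" where
  "wreath_t = Wreath 0 1"

definition wreath_generators :: "'l::group_add set \<Rightarrow> 'l wreath set" where
  "wreath_generators S = wreath_base ` S \<union> {wreath_t, - wreath_t}"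

end

theory Submission
  imports Defs
begin

text \<open>
  Over the semiring of natural numbers nothing cancels, so a proper linear system for the complete
  growth series is a finite automaton: its unknowns are states, a monomial \<open>r X\<^sub>j s\<^sup>k\<close> in the
  equation of \<open>X\<^sub>i\<close> gives edges from \<open>i\<close> to \<open>j\<close> labelled by the elements of the support of
  \<open>r\<close>, with weight \<open>k\<close>, and every accepting path from state 1 multiplies out to an element whose
  word length is \<^emph>\<open>exactly\<close> the total weight. For a suitable constant \<open>C\<close>, completing a part of an
  accepting path by a fixed path shows that the word length of any initial or final part
  exceeds its weight by at most \<open>C / 2\<close>. Hence if an accepting path factors as \<open>p c q\<close> with \<open>c\<close> a cycle
  of the automaton, then \<open>|p| + |c\<^sup>k q| \<le> |p c\<^sup>k q| + C\<close> for all \<open>k\<close>: pumping never produces a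
  shortcut between the prefix and the rest (\<open>rational_growth_pumping\<close>).

  In the wreath product such shortcuts do arise. Let \<open>[a, b]\<close> be the convex hull of \<open>0\<close>, \<open>m\<close> and
  the support of \<open>f\<close>. Then \<open>f t\<^sup>m\<close> has length \<open>\<Sum>|f i| + 2 (b - a) - |m|\<close>: the cursor starts at
  \<open>0\<close>, visits both ends of \<open>[a, b]\<close> and stops at \<open>m\<close>, so it goes first to the end that is
  opposite to \<open>m\<close>. If \<open>p\<close> leaves the cursor at a nonnegative position but has lit a lamp at \<open>- n\<close>,
  and \<open>v\<close> then moves the cursor far to the left, the detour to \<open>- n\<close> made by \<open>p\<close> is superfluous:
  the lamps on that side can be lit in passing during \<open>v\<close>. So \<open>|p v| \<le> |p| + |v| - 2 n\<close>
  (\<open>detour_saved\<close>), which is incompatible with the first paragraph if \<open>v = c\<^sup>k q\<close> and \<open>2 n > C\<close>.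

  It remains to find such a factorisation. Take the element with lamps at \<open>- n\<close> and \<open>2 n\<close> and the
  cursor at \<open>n\<close>, for large \<open>n\<close>. It must be built by going left first, then to \<open>2 n\<close>, then back to
  \<open>n\<close>. An accepting path for it is a geodesic up to bounded error, so while the cursor
  descends from \<open>2 n\<close> to \<open>n\<close> both lamps are on. This descent is longer than the number of
  states allows without a repetition, and the cycle so obtained moves the cursor to the left.
\<close>

section \<open>Word length\<close>

lemma sum_list_rev_uminus: "sum_list (rev (map uminus ws)) = - sum_list (ws :: 'g::group_add list)"
  by (induction ws) (simp_all add: minus_add)

lemma word_length_le:
  assumes "set ws \<subseteq> T"
  shows "word_length T (sum_list ws) \<le> length ws"
  unfolding word_length_def by (rule Least_le) (use assms in blast)

lemma generates_imp_words:
  assumes "symmetric S" and "generates S"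
  shows "\<exists>ws. set ws \<subseteq> S \<and> sum_list ws = g"
proof -
  let ?H = "{g. \<exists>ws. set ws \<subseteq> S \<and> sum_list ws = g}"
  have neg: "\<exists>vs. set vs \<subseteq> S \<and> sum_list vs = - sum_list ws" if "set ws \<subseteq> S" for ws
    using that assms(1)
    by (intro exI[of _ "rev (map uminus ws)"]) (auto simp: sum_list_rev_uminus symmetric_def)
  have add: "\<exists>ws. set ws \<subseteq> S \<and> sum_list ws = sum_list us + sum_list vs"
    if "set us \<subseteq> S" "set vs \<subseteq> S" for us vs
    using that by (intro exI[of _ "us @ vs"]) simp
  have "subgroup_add ?H"
    unfolding subgroup_add_def
  proof (intro conjI ballI)
    show "0 \<in> ?H" by (auto intro: exI[of _ "[]"])
  qed (use neg add in auto)
  moreover have "S \<subseteq> ?H"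
  proof
    fix x assume "x \<in> S"
    then show "x \<in> ?H" by (auto intro: exI[of _ "[x]"])
  qed
  ultimately have "subgroup_add hull S \<subseteq> ?H"
    by (rule hull_minimal[rotated])
  then show ?thesis
    using assms(2) by (auto simp: generates_def)
qed

locale word_metric =
  fixes T :: "'g::group_add set"
  assumes symmetric: "symmetric T"
    and words: "\<exists>ws. set ws \<subseteq> T \<and> sum_list ws = g"
begin

lemma geodesic:
  obtains ws where "set ws \<subseteq> T" "length ws = word_length T g" "sum_list ws = g"
proof -
  have "\<exists>n ws. set ws \<subseteq> T \<and> length ws = n \<and> sum_list ws = g"
    using words by auto
  from LeastI_ex[OF this] show thesis
    unfolding word_length_def[symmetric] using that by blast
qed

lemma word_length_zero [simp]: "word_length T 0 = 0"
  using word_length_le[of "[]" T] by simp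

lemma word_length_add: "word_length T (g + h) \<le> word_length T g + word_length T h"
proof -
  obtain us where "set us \<subseteq> T" "length us = word_length T g" "sum_list us = g"
    by (rule geodesic)
  moreover obtain vs where "set vs \<subseteq> T" "length vs = word_length T h" "sum_list vs = h"
    by (rule geodesic)
  ultimately show ?thesis
    using word_length_le[of "us @ vs" T] by simp
qed

lemma word_length_uminus_le: "word_length T (- g) \<le> word_length T g"
proof -
  obtain ws where ws: "set ws \<subseteq> T" "length ws = word_length T g" "sum_list ws = g"
    by (rule geodesic)
  have "set (rev (map uminus ws)) \<subseteq> T"
    using ws(1) symmetric by (auto simp: symmetric_def)
  then show ?thesis
    using word_length_le[of "rev (map uminus ws)" T] ws by (simp add: sum_list_rev_uminus)
qed

lemma word_length_uminus [simp]: "word_length T (- g) = word_length T g"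
  using word_length_uminus_le[of g] word_length_uminus_le[of "- g"] by simp

lemma finite_sphere:
  assumes "finite T"
  shows "finite {g. word_length T g = n}"
proof -
  have "g \<in> sum_list ` {ws. set ws \<subseteq> T \<and> length ws = n}" if "word_length T g = n" for g
  proof -
    obtain ws where "set ws \<subseteq> T" "length ws = word_length T g" "sum_list ws = g"
      by (rule geodesic)
    then show ?thesis using that by (intro image_eqI[of _ _ ws]) auto
  qed
  then have "{g. word_length T g = n} \<subseteq> sum_list ` {ws. set ws \<subseteq> T \<and> length ws = n}"
    by blast
  then show ?thesis
    by (rule finite_subset) (intro finite_imageI finite_lists_length_eq assms)
qed

lemma lookup_growth_series:
  assumes "finite T"
  shows "Poly_Mapping.lookup (fps_nth (complete_growth_series T) n) g \<noteq> 0 \<longleftrightarrow> word_length T g = n"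
proof -
  have "Poly_Mapping.lookup (fps_nth (complete_growth_series T) n) g
      = (\<Sum>h | word_length T h = n. 1 when h = g)"
    by (simp add: complete_growth_series_def lookup_sum lookup_single)
  also have "\<dots> = (if word_length T g = n then 1 else 0)"
    unfolding when_def by (subst sum.delta[OF finite_sphere[OF assms]]) simp
  finally show ?thesis by (simp split: if_splits)
qed

end

section \<open>Supports in the group semiring\<close>

text \<open>
  The three rules below compute supports exactly, because a sum of natural numbers vanishes only if
  all summands do. This is where the coefficients being natural numbers enters the proof.
\<close>

lemma keys_add_nat: "Poly_Mapping.keys (f + g :: 'a \<Rightarrow>\<^sub>0 nat) = Poly_Mapping.keys f \<union> Poly_Mapping.keys g"
  by (auto simp: in_keys_iff lookup_add)

lemma keys_sum_list_nat:
  "Poly_Mapping.keys (sum_list fs :: 'a \<Rightarrow>\<^sub>0 nat) = (\<Union>f\<in>set fs. Poly_Mapping.keys f)"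
  by (induction fs) (simp_all add: keys_add_nat)

lemma keys_mult_nat:
  fixes f g :: "'a::monoid_add \<Rightarrow>\<^sub>0 nat"
  shows "Poly_Mapping.keys (f * g) = {x + y | x y. x \<in> Poly_Mapping.keys f \<and> y \<in> Poly_Mapping.keys g}"
proof
  show "Poly_Mapping.keys (f * g) \<subseteq> {x + y | x y. x \<in> Poly_Mapping.keys f \<and> y \<in> Poly_Mapping.keys g}"
    using keys_mult[of f g] by blast
  have split: "\<exists>r. h = Poly_Mapping.single x 1 + r" if "x \<in> Poly_Mapping.keys h"
    for h :: "'a \<Rightarrow>\<^sub>0 nat" and x
  proof
    show "h = Poly_Mapping.single x 1 + (h - Poly_Mapping.single x 1)"
      using that
      by (intro poly_mapping_eqI) (auto simp: lookup_add lookup_minus lookup_single when_def in_keys_iff)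
  qed
  show "{x + y | x y. x \<in> Poly_Mapping.keys f \<and> y \<in> Poly_Mapping.keys g} \<subseteq> Poly_Mapping.keys (f * g)"
  proof clarify
    fix x y assume "x \<in> Poly_Mapping.keys f" "y \<in> Poly_Mapping.keys g"
    then obtain r s where "f = Poly_Mapping.single x 1 + r" "g = Poly_Mapping.single y 1 + s"
      using split by meson
    then have "f * g = Poly_Mapping.single (x + y) 1
        + (Poly_Mapping.single x 1 * s + r * Poly_Mapping.single y 1 + r * s)"
      by (simp add: distrib_left distrib_right mult_single add_ac)
    then show "x + y \<in> Poly_Mapping.keys (f * g)"
      by (simp add: keys_add_nat)
  qed
qed

section \<open>Linear systems as automata\<close>

text \<open>
  The labels of the automaton of a system. An edge has an element \<open>e\<close> and a weight \<open>d\<close>, the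
  exponent of the variable; constant monomials are the exits.
\<close>

definition edge :: "(nat \<Rightarrow> 'g group_semiring lin_monomial list) \<Rightarrow> nat \<Rightarrow> 'g \<Rightarrow> nat \<Rightarrow> nat \<Rightarrow> bool" where
  "edge P i e d j \<longleftrightarrow> (\<exists>r. Lin r j d \<in> set (P i) \<and> e \<in> Poly_Mapping.keys r)"

definition exit :: "(nat \<Rightarrow> 'g group_semiring lin_monomial list) \<Rightarrow> nat \<Rightarrow> 'g \<Rightarrow> nat \<Rightarrow> bool" where
  "exit P i e d \<longleftrightarrow> (\<exists>r. Const r d \<in> set (P i) \<and> e \<in> Poly_Mapping.keys r)"

inductive run :: "(nat \<Rightarrow> 'g::monoid_add group_semiring lin_monomial list) \<Rightarrow>
    nat \<Rightarrow> 'g \<Rightarrow> nat \<Rightarrow> nat \<Rightarrow> bool" for P where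
  run_refl: "run P i 0 0 i"
| run_step: "edge P i e d j \<Longrightarrow> run P j u k l \<Longrightarrow> run P i (e + u) (d + k) l"

definition in_support :: "(nat \<Rightarrow> 'g group_semiring fps) \<Rightarrow> nat \<Rightarrow> 'g \<Rightarrow> nat \<Rightarrow> bool" where
  "in_support X i v k \<longleftrightarrow> v \<in> Poly_Mapping.keys (fps_nth (X i) k)"

text \<open>
  The equation of \<open>X\<^sub>i\<close>, read on supports: a term of \<open>X\<^sub>i\<close> is the label of an exit, or an edge
  label times a term of the target. With the absence of cancellation this is an equivalence, so
  paths can be read off from terms (\<open>in_support_trace\<close>) and terms from paths (\<open>in_support_run\<close>).
\<close>

lemma in_support_iff:
  fixes P :: "nat \<Rightarrow> 'g::monoid_add group_semiring lin_monomial list"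
  assumes "proper_solution n P X" and "i \<in> {1..n}"
  shows "in_support X i v k \<longleftrightarrow>
    exit P i v k \<or> (\<exists>e d j w k'. edge P i e d j \<and> in_support X j w k' \<and> v = e + w \<and> k = d + k')"
proof -
  have nth_sum: "fps_nth (\<Sum>m\<leftarrow>ms. eval_monomial X m) k = (\<Sum>m\<leftarrow>ms. fps_nth (eval_monomial X m) k)" for ms
    by (induction ms) auto
  have "X i = (\<Sum>m\<leftarrow>P i. eval_monomial X m)"
    using assms by (simp add: proper_solution_def)
  then have "in_support X i v k \<longleftrightarrow>
      (\<exists>m\<in>set (P i). v \<in> Poly_Mapping.keys (fps_nth (eval_monomial X m) k))"
    unfolding in_support_def by (simp add: nth_sum keys_sum_list_nat)
  moreover have const: "v \<in> Poly_Mapping.keys (fps_nth (eval_monomial X (Const r d)) k)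
      \<longleftrightarrow> k = d \<and> v \<in> Poly_Mapping.keys r" for r d
    by (auto simp: fps_X_power_mult_right_nth)
  moreover have lin: "v \<in> Poly_Mapping.keys (fps_nth (eval_monomial X (Lin r j d)) k)
      \<longleftrightarrow> (\<exists>e\<in>Poly_Mapping.keys r. \<exists>w k'. in_support X j w k' \<and> v = e + w \<and> k = d + k')" for r j d
  proof (cases "k < d")
    case True
    then show ?thesis by (auto simp: fps_X_power_mult_right_nth)
  next
    case False
    then obtain k' where "k = d + k'" using le_Suc_ex not_less by blast
    then show ?thesis
      by (auto simp: fps_X_power_mult_right_nth keys_mult_nat in_support_def)
  qed
  have "(\<exists>m\<in>set (P i). Q m) \<longleftrightarrow> (\<exists>r d. Const r d \<in> set (P i) \<and> Q (Const r d)) \<or>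
     (\<exists>r j d. Lin r j d \<in> set (P i) \<and> Q (Lin r j d))" for Q
    by (metis lin_monomial.exhaust)
  ultimately show ?thesis
    unfolding edge_def exit_def by (simp only: const lin) blast
qed

lemma edge_proper:
  assumes "proper_linear_system n P" and "i \<in> {1..n}" and "edge P i e d j"
  shows "j \<in> {1..n}" and "1 \<le> d"
  using assms by (force simp: proper_linear_system_def edge_def)+

lemma in_support_run:
  fixes P :: "nat \<Rightarrow> 'g::monoid_add group_semiring lin_monomial list"
  assumes P: "proper_linear_system n P" and X: "proper_solution n P X"
  shows "run P i u k j \<Longrightarrow> i \<in> {1..n} \<Longrightarrow> in_support X j v k' \<Longrightarrow> in_support X i (u + v) (k + k')"
proof (induction rule: run.induct)
  case (run_step i e d j u k l)
  then have "in_support X j (u + v) (k + k')"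
    using edge_proper[OF P] by blast
  then show ?case
    using run_step.hyps(1) in_support_iff[OF X run_step.prems(1)] by (metis add.assoc)
qed simp

text \<open>
  An accepting path for a given term, recorded by what remains to be read: \<open>v l\<close> and \<open>\<rho> l\<close> are the
  element and the weight still to be produced from the state \<open>st l\<close>. The path ends because
  all weights are positive.
\<close>

lemma in_support_trace:
  fixes P :: "nat \<Rightarrow> 'g::monoid_add group_semiring lin_monomial list"
  assumes P: "proper_linear_system n P" and X: "proper_solution n P X"
  shows "in_support X i g k \<Longrightarrow> i \<in> {1..n} \<Longrightarrow>
    \<exists>m v \<rho> st. v 0 = g \<and> \<rho> 0 = k \<and> st 0 = i \<and>
      (\<forall>l\<le>m. st l \<in> {1..n} \<and> in_support X (st l) (v l) (\<rho> l)) \<and>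
      (\<forall>l<m. \<exists>e d. edge P (st l) e d (st (Suc l)) \<and> v l = e + v (Suc l) \<and> \<rho> l = d + \<rho> (Suc l)) \<and>
      exit P (st m) (v m) (\<rho> m)"
proof (induction k arbitrary: i g rule: less_induct)
  case (less k)
  show ?case
  proof (cases "exit P i g k")
    case True
    then show ?thesis
      using less.prems
      by (intro exI[of _ 0] exI[of _ "\<lambda>_. g"] exI[of _ "\<lambda>_. k"] exI[of _ "\<lambda>_. i"]) auto
  next
    case False
    then obtain e d j w k' where e: "edge P i e d j" "in_support X j w k'" "g = e + w" "k = d + k'"
      using less.prems in_support_iff[OF X] by blast
    then have j: "j \<in> {1..n}" and "k' < k"
      using edge_proper[OF P less.prems(2) e(1)] by auto
    from less.IH[OF \<open>k' < k\<close> e(2) j] obtain m v \<rho> st where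
      "v 0 = w" "\<rho> 0 = k'" "st 0 = j"
      "\<forall>l\<le>m. st l \<in> {1..n} \<and> in_support X (st l) (v l) (\<rho> l)"
      "\<forall>l<m. \<exists>e d. edge P (st l) e d (st (Suc l)) \<and> v l = e + v (Suc l) \<and> \<rho> l = d + \<rho> (Suc l)"
      "exit P (st m) (v m) (\<rho> m)"
      by blast
    then show ?thesis
      using less.prems e
      by (intro exI[of _ "Suc m"] exI[of _ "case_nat g v"] exI[of _ "case_nat k \<rho>"]
          exI[of _ "case_nat i st"])
        (auto split: nat.split simp: less_Suc_eq_0_disj)
  qed
qed

lemma trace_run:
  assumes "\<forall>l<m. \<exists>e d. edge P (st l) e d (st (Suc l)) \<and> v l = e + v (Suc l) \<and> \<rho> l = d + \<rho> (Suc l)"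
    and "a \<le> b" and "b \<le> m"
  shows "\<exists>u h. run P (st a) u h (st b) \<and> v a = u + v b \<and> \<rho> a = h + \<rho> b"
  using assms(2,3)
proof (induction rule: inc_induct)
  case base
  show ?case by (intro exI[of _ 0]) (auto intro: run.intros)
next
  case (step l)
  then obtain u h where "run P (st (Suc l)) u h (st b)" "v (Suc l) = u + v b" "\<rho> (Suc l) = h + \<rho> b"
    by auto
  moreover obtain e d where "edge P (st l) e d (st (Suc l))" "v l = e + v (Suc l)" "\<rho> l = d + \<rho> (Suc l)"
    using assms(1) step by (meson less_le_trans)
  ultimately show ?case
    by (intro exI[of _ "e + u"] exI[of _ "d + h"]) (auto simp: add.assoc intro: run.intros)
qed

lemma in_support_funpow:
  fixes P :: "nat \<Rightarrow> 'g::monoid_add group_semiring lin_monomial list"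
  assumes "proper_linear_system n P" and "proper_solution n P X" and "i \<in> {1..n}"
    and "run P i c d i" and "in_support X i v k"
  shows "in_support X i (((+) c ^^ N) v) (N * d + k)"
proof (induction N)
  case (Suc N)
  then show ?case
    using in_support_run[OF assms(1,2,4,3)] by (simp add: add.assoc)
qed (use assms(5) in simp)

lemma finite_labels:
  fixes P :: "nat \<Rightarrow> 'g group_semiring lin_monomial list"
  shows "finite {e. \<exists>i\<in>{1..n}. (\<exists>d j. edge P i e d j) \<or> (\<exists>d. exit P i e d)}"
proof -
  define cf where "cf m = (case m of Const r d \<Rightarrow> Poly_Mapping.keys r | Lin r j d \<Rightarrow> Poly_Mapping.keys r)"
    for m :: "'g group_semiring lin_monomial"
  have sub: "{e. \<exists>i\<in>{1..n}. (\<exists>d j. edge P i e d j) \<or> (\<exists>d. exit P i e d)}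
      \<subseteq> (\<Union>i\<in>{1..n}. \<Union>m\<in>set (P i). cf m)"
    by (force simp: edge_def exit_def cf_def)
  have "finite (cf m)" for m by (cases m) (auto simp: cf_def)
  then show ?thesis by (intro finite_subset[OF sub]) simp
qed

text \<open>
  The consequence of rationality, in terms of word lengths only: \<open>u l\<close> are the partial products
  along an accepting path for \<open>g\<close>, which move by bounded steps, and \<open>st l\<close> are its states. If
  \<open>a\<close> and \<open>b\<close> carry the same state, then \<open>p = u a\<close>, \<open>c = - u a + u b\<close> and \<open>q = - u b + g\<close> factor
  \<open>g\<close>, and the iterate of \<open>(+) c\<close> is \<open>c\<^sup>N q\<close>. The case \<open>a = b\<close> says that every \<open>u l\<close> with \<open>l < m\<close>
  lies close to a geodesic from \<open>0\<close> to \<open>g\<close>.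
\<close>

definition has_pumping_path :: "'g::group_add set \<Rightarrow> nat \<Rightarrow> nat \<Rightarrow> 'g \<Rightarrow> bool" where
  "has_pumping_path T C n g \<longleftrightarrow> (\<exists>m u st. u 0 = 0 \<and> u m = g \<and>
     (\<forall>l<m. st l \<in> {1..n} \<and> word_length T (- u l + u (Suc l)) \<le> C) \<and>
     (\<forall>a b N. a \<le> b \<longrightarrow> b < m \<longrightarrow> st a = st b \<longrightarrow>
       word_length T (u a) + word_length T (((+) (- u a + u b) ^^ N) (- u b + g))
         \<le> word_length T (u a + ((+) (- u a + u b) ^^ N) (- u b + g)) + C))"

text \<open>
  Every term \<open>g s\<^sup>k\<close> of the growth series has \<open>k = |g|\<close>, so weights of accepting paths are
  lengths of their products. For each state a fixed completion in each direction bounds the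
  difference between length and weight of partial paths, and the pumped paths are accepting too.
\<close>

theorem (in word_metric) rational_growth_pumping:
  assumes fin: "finite T" and rat: "rational_series (complete_growth_series T)"
  obtains C n where "\<And>g. g \<noteq> 0 \<Longrightarrow> has_pumping_path T C n g"
proof -
  let ?len = "word_length T"
  from rat obtain n P X where n: "1 \<le> n" and P: "proper_linear_system n P"
    and X: "proper_solution n P X"
    and X1: "X 1 = Abs_fps (\<lambda>k. if k = 0 then 0 else fps_nth (complete_growth_series T) k)"
    unfolding rational_series_def by blast
  have one: "1 \<in> {1..n}" using n by simp
  have supp1: "in_support X 1 g k \<longleftrightarrow> k \<noteq> 0 \<and> ?len g = k" for g k
    using lookup_growth_series[OF fin, of k g] unfolding in_support_def X1 in_keys_iff by simp
  have len_run: "?len (u + v) = h + k" if "run P 1 u h j" "in_support X j v k" for u h j v k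
    using in_support_run[OF P X that(1) one that(2)] supp1 by simp
  have sub1: "?len u \<le> ?len (u + v) + ?len v" for u v
    using word_length_add[of "u + v" "- v"] by simp
  have sub2: "?len v \<le> ?len u + ?len (u + v)" for u v
    using word_length_add[of "- u" "u + v"] by (simp add: add.assoc[symmetric])
  \<comment> \<open>Complete \<open>u\<close> and \<open>v\<close> by one fixed accepting path through \<open>j\<close>, if there is any.\<close>
  have "\<exists>D. \<forall>u h v k. run P 1 u h j \<longrightarrow> in_support X j v k \<longrightarrow> ?len u \<le> h + D \<and> ?len v \<le> k + D" for j
  proof (cases "\<exists>u h v k. run P 1 u h j \<and> in_support X j v k")
    case False
    then show ?thesis by blast
  next
    case True
    then obtain u0 h0 v0 k0 where 0: "run P 1 u0 h0 j" "in_support X j v0 k0" by blast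
    have "?len u \<le> h + (h0 + k0 + ?len u0 + ?len v0) \<and> ?len v \<le> k + (h0 + k0 + ?len u0 + ?len v0)"
      if "run P 1 u h j" "in_support X j v k" for u h v k
      using sub1[of u v0] len_run[OF that(1) 0(2)] sub2[of v u0] len_run[OF 0(1) that(2)] by simp
    then show ?thesis by blast
  qed
  then obtain D where D: "\<And>j u h v k. run P 1 u h j \<Longrightarrow> in_support X j v k \<Longrightarrow>
      ?len u \<le> h + D j \<and> ?len v \<le> k + D j"
    by metis
  define E where "E = {e. \<exists>i\<in>{1..n}. (\<exists>d j. edge P i e d j) \<or> (\<exists>d. exit P i e d)}"
  have finE: "finite E" unfolding E_def by (rule finite_labels)
  define C where "C = 2 * (\<Sum>j\<in>{1..n}. D j) + (\<Sum>e\<in>E. ?len e)"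
  have CD: "2 * D j \<le> C" if "j \<in> {1..n}" for j
    using member_le_sum[OF that, of D] by (simp add: C_def)
  have CE: "?len e \<le> C" if "e \<in> E" for e
    using member_le_sum[OF that _ finE, of ?len] by (simp add: C_def)
  show thesis
  proof (rule that[of C n])
    fix g :: 'g assume "g \<noteq> 0"
    obtain ws where "length ws = ?len g" "sum_list ws = g" by (rule geodesic)
    then have "?len g \<noteq> 0" using \<open>g \<noteq> 0\<close> by (metis length_0_conv sum_list.Nil)
    then have "in_support X 1 g (?len g)" using supp1 by simp
    from in_support_trace[OF P X this one] obtain m v \<rho> st where
      start: "v 0 = g" "\<rho> 0 = ?len g" "st 0 = 1" and
      supp: "\<forall>l\<le>m. st l \<in> {1..n} \<and> in_support X (st l) (v l) (\<rho> l)" and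
      tr: "\<forall>l<m. \<exists>e d. edge P (st l) e d (st (Suc l)) \<and> v l = e + v (Suc l) \<and> \<rho> l = d + \<rho> (Suc l)" and
      ex: "exit P (st m) (v m) (\<rho> m)"
      by blast
    \<comment> \<open>The exit is taken as a last step, so the path of partial products has \<open>m + 1\<close> steps.\<close>
    define u where "u l = (if l \<le> m then g - v l else g)" for l
    have u0: "u 0 = 0" and um: "u (Suc m) = g" by (simp_all add: u_def start)
    have rest: "- u l + g = v l" if "l \<le> m" for l
      using that by (simp add: u_def algebra_simps)
    have step: "- u l + u (Suc l) \<in> E" if "l \<le> m" for l
    proof (cases "l = m")
      case True
      then show ?thesis
        using ex supp by (auto simp: E_def rest um)
    next
      case False
      with that have "l < m" by simp
      then obtain e d where e: "edge P (st l) e d (st (Suc l))" "v l = e + v (Suc l)"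
        using tr by blast
      have "- u l + u (Suc l) = - u l + g - v (Suc l)"
        using \<open>l < m\<close> by (simp add: u_def add_diff_eq)
      also have "\<dots> = e" using rest \<open>l < m\<close> e(2) by simp
      finally show ?thesis using e(1) supp \<open>l \<le> m\<close> unfolding E_def by blast
    qed
    have pump: "?len (u a) + ?len (((+) (- u a + u b) ^^ N) (- u b + g))
          \<le> ?len (u a + ((+) (- u a + u b) ^^ N) (- u b + g)) + C"
      if ab: "a \<le> b" "b < Suc m" "st a = st b" for a b N
    proof -
      have "b \<le> m" "a \<le> m" using ab by auto
      obtain p h where p: "run P 1 p h (st a)" "g = p + v a"
        using trace_run[OF tr, of 0 a] \<open>a \<le> m\<close> start by auto
      obtain c d where c: "run P (st a) c d (st a)" "v a = c + v b"
        using trace_run[OF tr, of a b] ab \<open>b \<le> m\<close> by auto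
      have ua: "u a = p" using p(2) \<open>a \<le> m\<close> by (simp add: u_def)
      have cyc: "- u a + u b = c"
        using c(2) rest[OF \<open>a \<le> m\<close>] rest[OF \<open>b \<le> m\<close>]
        by (metis add.assoc add_right_cancel minus_add_cancel add_minus_cancel)
      have sta: "st a \<in> {1..n}" "in_support X (st a) (v b) (\<rho> b)"
        using supp \<open>a \<le> m\<close> \<open>b \<le> m\<close> ab(3) by auto
      let ?w = "((+) c ^^ N) (v b)"
      have w: "in_support X (st a) ?w (N * d + \<rho> b)"
        by (rule in_support_funpow[OF P X sta(1) c(1) sta(2)])
      show ?thesis
        unfolding cyc unfolding ua rest[OF \<open>b \<le> m\<close>]
        using len_run[OF p(1) w] D[OF p(1) w] CD[OF sta(1)] by simp
    qed
    show "has_pumping_path T C n g"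
      unfolding has_pumping_path_def
      using u0 um supp step CE pump
      by (intro exI[of _ "Suc m"] exI[of _ u] exI[of _ st]) (simp add: less_Suc_eq_le)
  qed
qed

section \<open>Word length in the wreath product\<close>

primrec lamps :: "'l::zero wreath \<Rightarrow> int \<Rightarrow>\<^sub>0 'l" where
  "lamps (Wreath f m) = f"

primrec cursor :: "'l::zero wreath \<Rightarrow> int" where
  "cursor (Wreath f m) = m"

abbreviation lamp :: "'l::zero wreath \<Rightarrow> int \<Rightarrow> 'l" where
  "lamp g i \<equiv> Poly_Mapping.lookup (lamps g) i"

lemma cursor_zero [simp]: "cursor 0 = 0" and lamps_zero [simp]: "lamps 0 = 0"
  by (simp_all add: zero_wreath_def)

lemma cursor_add [simp]: "cursor (g + h) = cursor g + cursor h"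
  by (cases g; cases h) simp

lemma lamps_add: "lamps (g + h) = lamps g + shift (cursor g) (lamps h)"
  by (cases g; cases h) simp

lemma lamp_add [simp]: "lamp (g + h) i = lamp g i + lamp h (i - cursor g)"
  by (simp add: lamps_add lookup_add)

lemma cursor_uminus [simp]: "cursor (- g) = - cursor g"
  by (cases g) simp

lemma lamp_uminus [simp]: "lamp (- g) i = - lamp g (i + cursor g)"
  by (cases g) (simp add: Poly_Mapping.map.rep_eq when_def)

lemma cursor_diff [simp]: "cursor (g - h) = cursor g - cursor h"
  by (simp add: diff_conv_add_uminus del: add_uminus_conv_diff)

lemma lamp_diff [simp]: "lamp (g - h) i = lamp g i - lamp h (i - cursor g + cursor h)"
  by (simp add: diff_conv_add_uminus del: add_uminus_conv_diff)

lemma wreath_eqI: "cursor g = cursor h \<Longrightarrow> (\<And>i. lamp g i = lamp h i) \<Longrightarrow> g = h"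
  by (cases g; cases h) (simp add: poly_mapping_eqI)

lemma wreath_base_sel [simp]:
  "cursor (wreath_base x) = 0" "lamps (wreath_base x) = Poly_Mapping.single 0 x"
  by (simp_all add: wreath_base_def)

lemma wreath_t_sel [simp]: "cursor wreath_t = 1" "lamps wreath_t = 0"
  by (simp_all add: wreath_t_def)

text \<open>
  Any interval that the cursor may stay in while building \<open>g\<close>; requiring bounds rather than the
  exact hull lets them be enlarged freely along a word.
\<close>

definition hull_bounds :: "int \<Rightarrow> int \<Rightarrow> 'l::zero wreath \<Rightarrow> bool" where
  "hull_bounds a b g \<longleftrightarrow> a \<le> 0 \<and> 0 \<le> b \<and> a \<le> cursor g \<and> cursor g \<le> b \<and>
     (\<forall>i. lamp g i \<noteq> 0 \<longrightarrow> a \<le> i \<and> i \<le> b)"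

definition lamp_cost :: "'l::group_add set \<Rightarrow> 'l wreath \<Rightarrow> nat" where
  "lamp_cost S g = (\<Sum>i\<in>Poly_Mapping.keys (lamps g). word_length S (lamp g i))"

context word_metric
begin

lemma lamp_cost_superset:
  assumes "finite A" and "\<And>i. lamp g i \<noteq> 0 \<Longrightarrow> i \<in> A"
  shows "lamp_cost T g = (\<Sum>i\<in>A. word_length T (lamp g i))"
  unfolding lamp_cost_def
  by (rule sum.mono_neutral_left) (use assms in \<open>auto simp: in_keys_iff\<close>)

lemma lamp_cost_bij:
  assumes "bij \<pi>" and "\<And>i. word_length T (lamp g (\<pi> i)) = word_length T (lamp h i)"
    and "\<And>i. lamp g (\<pi> i) = 0 \<longleftrightarrow> lamp h i = 0"
  shows "lamp_cost T g = lamp_cost T h"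
  unfolding lamp_cost_def
proof (rule sum.reindex_bij_betw[symmetric, THEN trans])
  show "bij_betw \<pi> (Poly_Mapping.keys (lamps h)) (Poly_Mapping.keys (lamps g))"
    unfolding bij_betw_def
  proof
    show "inj_on \<pi> (Poly_Mapping.keys (lamps h))"
      using assms(1) by (meson bij_betw_def inj_on_subset subset_UNIV)
    show "\<pi> ` Poly_Mapping.keys (lamps h) = Poly_Mapping.keys (lamps g)"
    proof (safe)
      fix i assume i: "i \<in> Poly_Mapping.keys (lamps g)"
      obtain j where "i = \<pi> j" using assms(1) by (metis bij_pointE)
      with i assms(3) show "i \<in> \<pi> ` Poly_Mapping.keys (lamps h)" by (auto simp: in_keys_iff)
    qed (use assms(3) in \<open>auto simp: in_keys_iff\<close>)
  qed
qed (use assms(2) in auto)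

lemma lamp_cost_uminus [simp]: "lamp_cost T (- g) = lamp_cost T g"
  by (rule lamp_cost_bij[of "\<lambda>i. i - cursor g"]) (auto intro: bij_betwI[of _ _ _ "\<lambda>i. i + cursor g"])

lemma lamp_cost_add: "lamp_cost T (g + h) \<le> lamp_cost T g + lamp_cost T h"
proof -
  let ?A = "Poly_Mapping.keys (lamps g) \<union> (\<lambda>i. i + cursor g) ` Poly_Mapping.keys (lamps h)"
  have "i \<in> ?A" if "lamp h (i - cursor g) \<noteq> 0" for i
    using that by (intro UnI2 image_eqI[of _ _ "i - cursor g"]) (auto simp: in_keys_iff)
  then have "lamp_cost T (g + h) = (\<Sum>i\<in>?A. word_length T (lamp (g + h) i))"
    by (intro lamp_cost_superset) (auto simp: in_keys_iff)
  also have "\<dots> \<le> (\<Sum>i\<in>?A. word_length T (lamp g i) + word_length T (lamp h (i - cursor g)))"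
    by (intro sum_mono) (simp add: word_length_add)
  also have "\<dots> = lamp_cost T g + (\<Sum>i\<in>?A. word_length T (lamp h (i - cursor g)))"
    by (subst lamp_cost_superset[of ?A g]) (auto simp: in_keys_iff sum.distrib)
  also have "(\<Sum>i\<in>?A. word_length T (lamp h (i - cursor g)))
      = (\<Sum>i\<in>(\<lambda>i. i + cursor g) ` Poly_Mapping.keys (lamps h). word_length T (lamp h (i - cursor g)))"
  proof (rule sum.mono_neutral_right)
    show "\<forall>i\<in>?A - (\<lambda>i. i + cursor g) ` Poly_Mapping.keys (lamps h). word_length T (lamp h (i - cursor g)) = 0"
    proof
      fix i assume "i \<in> ?A - (\<lambda>i. i + cursor g) ` Poly_Mapping.keys (lamps h)"
      then have "i - cursor g \<notin> Poly_Mapping.keys (lamps h)"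
        by (metis DiffD2 diff_add_cancel image_eqI)
      then show "word_length T (lamp h (i - cursor g)) = 0" by (simp add: in_keys_iff)
    qed
  qed auto
  also have "\<dots> = lamp_cost T h"
    by (subst sum.reindex) (auto simp: lamp_cost_def)
  finally show ?thesis .
qed

lemma lamp_cost_base: "lamp_cost T (wreath_base x) = word_length T x"
  by (subst lamp_cost_superset[of "{0}"]) (auto simp: lookup_single when_def split: if_splits)

text \<open>
  The lower bound for word length in the wreath product. The claimed cost grows by at most one with
  each letter: when the cursor leaves \<open>[a, b]\<close>, the interval grows by one, which costs two, but
  the cursor then moves away from \<open>0\<close>, which gains one.
\<close>

lemma word_cost_lower:
  assumes "set ws \<subseteq> wreath_generators T"
  shows "\<exists>a b. hull_bounds a b (sum_list ws) \<and>
    int (lamp_cost T (sum_list ws)) + 2 * (b - a) - \<bar>cursor (sum_list ws)\<bar> \<le> int (length ws)"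
  using assms
proof (induction ws rule: rev_induct)
  case Nil
  show ?case by (intro exI[of _ 0]) (simp add: hull_bounds_def lamp_cost_def)
next
  case (snoc s ws)
  let ?g = "sum_list ws"
  obtain a b where ab: "hull_bounds a b ?g"
    "int (lamp_cost T ?g) + 2 * (b - a) - \<bar>cursor ?g\<bar> \<le> int (length ws)"
    using snoc by auto
  have "s \<in> wreath_generators T" using snoc.prems by simp
  then consider x where "x \<in> T" "s = wreath_base x" | "s = wreath_t" | "s = - wreath_t"
    by (auto simp: wreath_generators_def)
  then show ?case
  proof cases
    case 1
    have "word_length T x \<le> 1" using word_length_le[of "[x]" T] 1(1) by simp
    then have "lamp_cost T (?g + s) \<le> lamp_cost T ?g + 1"
      using lamp_cost_add[of ?g s] by (simp add: 1(2) lamp_cost_base)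
    moreover have "hull_bounds a b (?g + s)"
      using ab(1) by (auto simp: hull_bounds_def 1(2) lookup_single when_def)
    ultimately show ?thesis
      using ab(2) by (intro exI[of _ a] exI[of _ b]) (simp add: 1(2))
  next
    case 2
    have "lamp_cost T (?g + s) \<le> lamp_cost T ?g"
      using lamp_cost_add[of ?g s] by (simp add: 2 lamp_cost_def)
    moreover have "hull_bounds a (max b (cursor ?g + 1)) (?g + s)"
      using ab(1) by (auto simp: hull_bounds_def 2)
    moreover have "cursor ?g \<le> b" "0 \<le> b" using ab(1) by (auto simp: hull_bounds_def)
    then have "2 * max b (cursor ?g + 1) - \<bar>cursor ?g + 1\<bar> \<le> 2 * b - \<bar>cursor ?g\<bar> + 1"
      by (auto simp: max_def min_def abs_if)
    ultimately show ?thesis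
      using ab(2) by (intro exI[of _ a] exI[of _ "max b (cursor ?g + 1)"] conjI) (simp_all add: 2)
  next
    case 3
    have "lamp_cost T (?g + s) \<le> lamp_cost T ?g"
      using lamp_cost_add[of ?g s] by (simp add: 3) (simp add: lamp_cost_def)
    moreover have "hull_bounds (min a (cursor ?g - 1)) b (?g + s)"
      using ab(1) by (auto simp: hull_bounds_def 3)
    moreover have "a \<le> cursor ?g" "a \<le> 0" using ab(1) by (auto simp: hull_bounds_def)
    then have "- 2 * min a (cursor ?g - 1) - \<bar>cursor ?g - 1\<bar> \<le> - 2 * a - \<bar>cursor ?g\<bar> + 1"
      by (auto simp: max_def min_def abs_if)
    ultimately show ?thesis
      using ab(2) by (intro exI[of _ "min a (cursor ?g - 1)"] exI[of _ b] conjI) (simp_all add: 3)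
  qed
qed


text \<open>
  An upper bound for word length that presupposes neither that all elements are products of
  generators nor that the bound is attained; the former is a consequence of the lemmas below.
\<close>

definition spelled :: "nat \<Rightarrow> 'g wreath \<Rightarrow> bool" where
  "spelled n g \<longleftrightarrow> (\<exists>ws. set ws \<subseteq> wreath_generators T \<and> length ws \<le> n \<and> sum_list ws = g)"

lemma spelled_add: "spelled m g \<Longrightarrow> spelled n h \<Longrightarrow> spelled (m + n) (g + h)"
  unfolding spelled_def
proof clarify
  fix us vs
  assume "set us \<subseteq> wreath_generators T" "length us \<le> m" "set vs \<subseteq> wreath_generators T" "length vs \<le> n"
  then show "\<exists>ws. set ws \<subseteq> wreath_generators T \<and> length ws \<le> m + n \<and>
      sum_list ws = sum_list us + sum_list vs"
    by (intro exI[of _ "us @ vs"]) simp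
qed

lemma spelled_generator: "x \<in> wreath_generators T \<Longrightarrow> spelled 1 x"
  unfolding spelled_def by (intro exI[of _ "[x]"]) simp

lemma spelled_zero: "spelled 0 0"
  unfolding spelled_def by (intro exI[of _ "[]"]) simp

lemma symmetric_wreath_generators: "symmetric (wreath_generators T)"
proof -
  have "- wreath_base x = wreath_base (- x)" for x :: 'g
    by (rule wreath_eqI) (simp_all add: lookup_single when_def)
  then show ?thesis
    using symmetric by (auto simp: symmetric_def wreath_generators_def)
qed

lemma spelled_uminus:
  assumes "spelled n g"
  shows "spelled n (- g)"
proof -
  obtain ws where ws: "set ws \<subseteq> wreath_generators T" "length ws \<le> n" "sum_list ws = g"
    using assms by (auto simp: spelled_def)
  then show ?thesis
    using symmetric_wreath_generators unfolding spelled_def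
    by (intro exI[of _ "rev (map uminus ws)"]) (auto simp: symmetric_def sum_list_rev_uminus)
qed

lemma spelled_shift: "spelled (nat \<bar>k\<bar>) (Wreath 0 k)"
proof -
  have pos: "spelled n (Wreath 0 (int n))" for n
  proof (induction n)
    case 0
    then show ?case using spelled_zero by (simp add: zero_wreath_def)
  next
    case (Suc n)
    have "Wreath 0 (int (Suc n)) = Wreath 0 (int n) + (wreath_t :: 'g wreath)"
      by (rule wreath_eqI) simp_all
    moreover have "spelled 1 wreath_t"
      by (rule spelled_generator) (simp add: wreath_generators_def)
    from spelled_add[OF Suc this] have "spelled (Suc n) (Wreath 0 (int n) + wreath_t)" by simp
    ultimately show ?case by metis
  qed
  show ?thesis
  proof (cases "k \<ge> 0")
    case True
    then show ?thesis using pos[of "nat k"] by simp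
  next
    case False
    have "Wreath 0 k = - (Wreath 0 (- k) :: 'g wreath)"
      by (rule wreath_eqI) (simp_all del: uminus_wreath.simps)
    then show ?thesis using False spelled_uminus[OF pos[of "nat (- k)"]] by simp
  qed
qed

lemma spelled_base: "spelled (word_length T x) (wreath_base x)"
proof -
  obtain ws where ws: "set ws \<subseteq> T" "length ws = word_length T x" "sum_list ws = x"
    by (rule geodesic)
  have "sum_list (map wreath_base vs) = wreath_base (sum_list vs)" for vs :: "'g list"
    by (induction vs) (auto intro!: wreath_eqI simp: lookup_single when_def)
  then show ?thesis
    using ws unfolding spelled_def
    by (intro exI[of _ "map wreath_base ws"]) (auto simp: wreath_generators_def)
qed

text \<open>One pass from left to right, setting each lamp when the cursor is on it.\<close>

lemma spelled_sweep:
  assumes "cursor g = int n" and "\<And>i. lamp g i \<noteq> 0 \<Longrightarrow> 0 \<le> i \<and> i \<le> int n"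
  shows "spelled (lamp_cost T g + n) g"
  using assms
proof (induction n arbitrary: g)
  case 0
  have "g = wreath_base (lamp g 0)"
    using 0 by (intro wreath_eqI) (force simp: lookup_single when_def)+
  moreover from this have "lamp_cost T g = word_length T (lamp g 0)"
    using lamp_cost_base by metis
  ultimately show ?case using spelled_base[of "lamp g 0"] by simp
next
  case (Suc n)
  define h where "h = Wreath (Poly_Mapping.update (int (Suc n)) 0 (lamps g)) (int n)"
  have lh: "lamp h i = (if i = int (Suc n) then 0 else lamp g i)" for i
    by (simp add: h_def lookup_update)
  have ch: "cursor h = int n" by (simp add: h_def)
  have supp: "0 \<le> i \<and> i \<le> int n" if "lamp h i \<noteq> 0" for i
    using Suc.prems(2)[of i] that by (auto simp: lh split: if_splits)
  have g: "g = h + (wreath_t + wreath_base (lamp g (int (Suc n))))"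
    by (rule wreath_eqI) (auto simp: ch lh Suc.prems(1) lookup_single when_def diff_eq_eq)
  have "lamp_cost T h = (\<Sum>i\<in>{0..int n}. word_length T (lamp g i))"
    using supp by (subst lamp_cost_superset[of "{0..int n}"]) (auto simp: lh)
  moreover have "lamp_cost T g = (\<Sum>i\<in>insert (int (Suc n)) {0..int n}. word_length T (lamp g i))"
    using Suc.prems(2) by (intro lamp_cost_superset) (force)+
  ultimately have cost: "lamp_cost T g = lamp_cost T h + word_length T (lamp g (int (Suc n)))"
    by simp
  have "spelled 1 wreath_t"
    by (rule spelled_generator) (simp add: wreath_generators_def)
  from spelled_add[OF Suc.IH[OF ch supp] spelled_add[OF this spelled_base[of "lamp g (int (Suc n))"]]]
  show ?case
    unfolding g[symmetric] by (simp add: cost add_ac)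
qed

text \<open>
  If the cursor ends at a nonnegative position, go to \<open>a\<close>, sweep to \<open>b\<close> and return. The other case
  is that of the inverse, which has the same lamp cost and whose hull is translated by \<open>- cursor g\<close>.
\<close>

lemma word_cost_upper:
  assumes "hull_bounds a b g"
  shows "spelled (nat (int (lamp_cost T g) + 2 * (b - a) - \<bar>cursor g\<bar>)) g"
proof -
  have nonneg: "spelled (nat (int (lamp_cost T g) + 2 * (b - a) - \<bar>cursor g\<bar>)) g"
    if H: "hull_bounds a b g" and "0 \<le> cursor g" for a b and g :: "'g wreath"
  proof -
    define w where "w = Wreath (shift (- a) (lamps g)) (b - a)"
    have ab: "a \<le> 0" "0 \<le> b" "cursor g \<le> b" using H by (auto simp: hull_bounds_def)
    have "spelled (lamp_cost T w + nat (b - a)) w"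
      using H ab by (intro spelled_sweep) (force simp: w_def hull_bounds_def)+
    moreover have "lamp_cost T w = lamp_cost T g"
      by (rule lamp_cost_bij[of "\<lambda>i. i - a"])
        (auto simp: w_def intro: bij_betwI[of _ _ _ "\<lambda>i. i + a"])
    ultimately have w: "spelled (lamp_cost T g + nat (b - a)) w" by simp
    have g: "Wreath 0 a + (w + Wreath 0 (cursor g - b)) = g"
      by (rule wreath_eqI) (auto simp: w_def lookup_add)
    have "nat \<bar>a\<bar> + (lamp_cost T g + nat (b - a) + nat \<bar>cursor g - b\<bar>)
        = nat (int (lamp_cost T g) + 2 * (b - a) - \<bar>cursor g\<bar>)"
      using ab \<open>0 \<le> cursor g\<close> by simp
    then show ?thesis
      using spelled_add[OF spelled_shift[of a] spelled_add[OF w spelled_shift[of "cursor g - b"]]]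
      by (simp only: g)
  qed
  show ?thesis
  proof (cases "0 \<le> cursor g")
    case True
    then show ?thesis using nonneg assms by blast
  next
    case False
    have "hull_bounds (a - cursor g) (b - cursor g) (- g)"
      using assms by (force simp: hull_bounds_def)
    from spelled_uminus[OF nonneg[OF this]] show ?thesis
      using False by simp
  qed
qed

lemma hull_bounds_exist: "\<exists>a b. hull_bounds a b g"
proof -
  let ?A = "insert 0 (insert (cursor g) (Poly_Mapping.keys (lamps g)))"
  have "Min ?A \<le> i \<and> i \<le> Max ?A" if "i \<in> ?A" for i
    using that by (intro conjI Min_le Max_ge) auto
  then have "hull_bounds (Min ?A) (Max ?A) g"
    unfolding hull_bounds_def in_keys_iff[symmetric] by blast
  then show ?thesis by blast
qed

lemma word_metric_wreath: "word_metric (wreath_generators T)"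
proof
  show "symmetric (wreath_generators T)" by (rule symmetric_wreath_generators)
  show "\<exists>ws. set ws \<subseteq> wreath_generators T \<and> sum_list ws = g" for g
    using hull_bounds_exist[of g] word_cost_upper[of _ _ g] by (auto simp: spelled_def)
qed

abbreviation wreath_length :: "'g wreath \<Rightarrow> nat" where
  "wreath_length \<equiv> word_length (wreath_generators T)"

lemma wreath_length_le:
  assumes "hull_bounds a b g"
  shows "int (wreath_length g) \<le> int (lamp_cost T g) + 2 * (b - a) - \<bar>cursor g\<bar>"
proof -
  obtain ws where "set ws \<subseteq> wreath_generators T" "sum_list ws = g"
    "length ws \<le> nat (int (lamp_cost T g) + 2 * (b - a) - \<bar>cursor g\<bar>)"
    using word_cost_upper[OF assms] by (auto simp: spelled_def)
  moreover have "0 \<le> int (lamp_cost T g) + 2 * (b - a) - \<bar>cursor g\<bar>"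
    using assms by (auto simp: hull_bounds_def)
  ultimately show ?thesis
    using word_length_le[of ws "wreath_generators T"] by simp
qed

lemma wreath_length_ge:
  obtains a b where "hull_bounds a b g"
    and "int (lamp_cost T g) + 2 * (b - a) - \<bar>cursor g\<bar> \<le> int (wreath_length g)"
proof -
  obtain ws where "set ws \<subseteq> wreath_generators T" "length ws = wreath_length g" "sum_list ws = g"
    by (rule word_metric.geodesic[OF word_metric_wreath])
  then show thesis
    using word_cost_lower[of ws] that by metis
qed

lemma reach_le_wreath_length:
  shows "\<bar>cursor g\<bar> \<le> int (wreath_length g)"
    and "lamp g i \<noteq> 0 \<Longrightarrow> \<bar>i\<bar> \<le> int (wreath_length g)"
proof -
  obtain a b where ab: "hull_bounds a b g"
    and "int (lamp_cost T g) + 2 * (b - a) - \<bar>cursor g\<bar> \<le> int (wreath_length g)"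
    by (rule wreath_length_ge)
  moreover have "\<bar>cursor g\<bar> \<le> b - a" using ab by (auto simp: hull_bounds_def)
  moreover have "0 \<le> int (lamp_cost T g)" by simp
  ultimately have "b - a \<le> int (wreath_length g)" by simp
  with ab show "\<bar>cursor g\<bar> \<le> int (wreath_length g)"
    and "lamp g i \<noteq> 0 \<Longrightarrow> \<bar>i\<bar> \<le> int (wreath_length g)"
    unfolding hull_bounds_def by (auto dest!: spec[of _ i])
qed

lemma wreath_length_ge_hull:
  assumes "x = 0 \<or> x = cursor g \<or> lamp g x \<noteq> 0" and "y = 0 \<or> y = cursor g \<or> lamp g y \<noteq> 0"
  shows "2 * (y - x) - \<bar>cursor g\<bar> \<le> int (wreath_length g)"
proof -
  obtain a b where ab: "hull_bounds a b g"
    and "int (lamp_cost T g) + 2 * (b - a) - \<bar>cursor g\<bar> \<le> int (wreath_length g)"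
    by (rule wreath_length_ge)
  moreover have "a \<le> x" "y \<le> b" using ab assms by (auto simp: hull_bounds_def)
  moreover have "0 \<le> int (lamp_cost T g)" by simp
  ultimately show ?thesis by (smt (verit))
qed

text \<open>
  In the length formula, \<open>p\<close> pays \<open>2 (b - a)\<close> for a hull that includes \<open>- K\<close>. If \<open>v\<close> carries the
  cursor to the left of \<open>a\<close>, then the left end of the hull of \<open>p + v\<close> is determined by \<open>v\<close> alone, so
  that the \<open>- 2 a \<ge> 2 K\<close> paid by \<open>p\<close> is saved.
\<close>

lemma detour_saved:
  assumes "0 \<le> cursor p" and "lamp p (- K) \<noteq> 0"
  shows "\<exists>D. \<forall>v. cursor v \<le> D \<longrightarrow>
    int (wreath_length (p + v)) + 2 * K \<le> int (wreath_length p) + int (wreath_length v)"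
proof -
  obtain a b where ab: "hull_bounds a b p"
    and p: "int (lamp_cost T p) + 2 * (b - a) - \<bar>cursor p\<bar> \<le> int (wreath_length p)"
    by (rule wreath_length_ge)
  have "a \<le> - K" using ab assms(2) by (auto simp: hull_bounds_def)
  have "int (wreath_length (p + v)) + 2 * K \<le> int (wreath_length p) + int (wreath_length v)"
    if v: "cursor v \<le> a - cursor p" for v
  proof -
    let ?y = "cursor p"
    obtain a' b' where ab': "hull_bounds a' b' v"
      and v': "int (lamp_cost T v) + 2 * (b' - a') - \<bar>cursor v\<bar> \<le> int (wreath_length v)"
      by (rule wreath_length_ge)
    have bounds: "a \<le> 0" "0 \<le> b" "?y \<le> b" "a' \<le> cursor v" "cursor v \<le> b'" "0 \<le> b'"
      using ab ab' by (auto simp: hull_bounds_def)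
    have "hull_bounds (?y + a') (max b (?y + b')) (p + v)"
      unfolding hull_bounds_def
    proof (intro conjI allI impI)
      fix i assume "lamp (p + v) i \<noteq> 0"
      then have "lamp p i \<noteq> 0 \<or> lamp v (i - ?y) \<noteq> 0" by auto
      then have "a \<le> i \<and> i \<le> b \<or> a' \<le> i - ?y \<and> i - ?y \<le> b'"
        using ab ab' by (auto simp: hull_bounds_def)
      then show "?y + a' \<le> i" "i \<le> max b (?y + b')" using bounds v by auto
    qed (use bounds v in auto)
    from wreath_length_le[OF this] lamp_cost_add[of p v]
    have "int (wreath_length (p + v)) \<le> int (lamp_cost T p) + int (lamp_cost T v)
        + 2 * (max b (?y + b') - (?y + a')) - \<bar>?y + cursor v\<bar>" by simp
    moreover have "max b (?y + b') \<le> b + b'" using bounds by auto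
    moreover have "\<bar>?y + cursor v\<bar> = - ?y - cursor v" "\<bar>cursor v\<bar> = - cursor v" "\<bar>?y\<bar> = ?y"
      using v bounds assms(1) by auto
    ultimately show ?thesis
      using p v' \<open>a \<le> - K\<close> by (smt (verit))
  qed
  then show ?thesis by blast
qed

lemma cursor_funpow: "cursor (((+) c ^^ N) q) = int N * cursor c + cursor q"
  by (induction N) (auto simp: algebra_simps)

end

theorem theorem4:
  fixes S :: "'l::group_add set"
  assumes "\<exists>x::'l. x \<noteq> 0"
    and "finite S" and "symmetric S" and "generates S"
  shows "\<not> rational_series (complete_growth_series (wreath_generators S))"
proof
  assume rat: "rational_series (complete_growth_series (wreath_generators S))"
  interpret word_metric S
    using assms generates_imp_words by unfold_locales auto
  interpret W: word_metric "wreath_generators S" by (rule word_metric_wreath)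
  have fin: "finite (wreath_generators S)"
    using assms(2) by (simp add: wreath_generators_def)
  obtain C N where
    path: "\<And>g. g \<noteq> 0 \<Longrightarrow> has_pumping_path (wreath_generators S) C N g"
    by (rule W.rational_growth_pumping[OF fin rat]) blast
  obtain x :: 'l where x: "x \<noteq> 0" using assms(1) by blast
  \<comment> \<open>Large enough for \<open>N + 1\<close> thresholds at distance \<open>C + 1\<close> strictly between \<open>n\<close> and
    \<open>2 n - 2 C\<close>, and for the two inequalities derived next.\<close>
  define n where "n = (int C + 1) * (int N + 3) + int (word_length S x) + 1"
  have "n \<ge> (int C + 1) * 3 + int (word_length S x) + 1"
    unfolding n_def by (intro add_mono mult_left_mono) auto
  then have n_C: "n > int C" "2 * n > 2 * int (word_length S x) + int C" by auto
  define g where "g = Wreath (Poly_Mapping.single (- n) x + Poly_Mapping.single (2 * n) x) n"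
  have "n > 0" using n_C by linarith
  have lamp_g: "lamp g i = (if i = - n \<or> i = 2 * n then x else 0)" for i
    using \<open>n > 0\<close> by (auto simp: g_def lookup_add lookup_single when_def)
  have cursor_g: "cursor g = n" by (simp add: g_def)
  have "lamp_cost S g = (\<Sum>i\<in>{- n, 2 * n}. word_length S (lamp g i))"
    by (rule lamp_cost_superset) (auto simp: lamp_g split: if_splits)
  then have "lamp_cost S g = 2 * word_length S x"
    using \<open>n > 0\<close> by (simp add: lamp_g)
  moreover have "hull_bounds (- n) (2 * n) g"
    using \<open>n > 0\<close> by (auto simp: hull_bounds_def lamp_g cursor_g split: if_splits)
  ultimately have len_g: "int (wreath_length g) \<le> 2 * int (word_length S x) + 5 * n"
    using wreath_length_le[of "- n" "2 * n" g] \<open>n > 0\<close> by (simp add: cursor_g)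
  have "g \<noteq> 0" using cursor_g \<open>n > 0\<close> by auto
  from path[OF this] obtain m u st where u0: "u 0 = 0" and um: "u m = g"
    and st: "\<And>l. l < m \<Longrightarrow> st l \<in> {1..N}"
    and step: "\<And>l. l < m \<Longrightarrow> wreath_length (- u l + u (Suc l)) \<le> C"
    and pump: "\<And>a b k. a \<le> b \<Longrightarrow> b < m \<Longrightarrow> st a = st b \<Longrightarrow>
        wreath_length (u a) + wreath_length (((+) (- u a + u b) ^^ k) (- u b + g))
          \<le> wreath_length (u a + ((+) (- u a + u b) ^^ k) (- u b + g)) + C"
    unfolding has_pumping_path_def by blast
  have cstep: "\<bar>cursor (u (Suc l)) - cursor (u l)\<bar> \<le> int C" if "l < m" for l
    using reach_le_wreath_length(1)[of "- u l + u (Suc l)"] step[OF that] by simp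
  \<comment> \<open>The last time at which the lamp at \<open>2 n\<close> is off. Right after it the cursor is near \<open>2 n\<close>.\<close>
  define l1 where "l1 = Max {l. l \<le> m \<and> lamp (u l) (2 * n) = 0}"
  have "0 \<in> {l. l \<le> m \<and> lamp (u l) (2 * n) = 0}" by (simp add: u0)
  moreover have fin1: "finite {l. l \<le> m \<and> lamp (u l) (2 * n) = 0}" by simp
  ultimately have "l1 \<in> {l. l \<le> m \<and> lamp (u l) (2 * n) = 0}"
    unfolding l1_def by (intro Max_in) auto
  then have l1: "l1 \<le> m" "lamp (u l1) (2 * n) = 0" by auto
  have "l1 \<noteq> m" using l1 um x lamp_g[of "2 * n"] by auto
  with l1 have "l1 < m" by simp
  have lit: "lamp (u l) (2 * n) \<noteq> 0" if "l1 < l" "l \<le> m" for l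
    using that Max_ge[OF fin1, of l] unfolding l1_def[symmetric] by auto
  have far: "2 * n - 2 * int C \<le> cursor (u (Suc l1))"
  proof -
    have "lamp (- u l1 + u (Suc l1)) (2 * n - cursor (u l1)) \<noteq> 0"
      using lit[of "Suc l1"] \<open>l1 < m\<close> l1(2) by simp
    from reach_le_wreath_length(2)[OF this] step[OF \<open>l1 < m\<close>]
    have "\<bar>2 * n - cursor (u l1)\<bar> \<le> int C" by simp
    then show ?thesis using cstep[OF \<open>l1 < m\<close>] by linarith
  qed
  \<comment> \<open>The time \<open>\<tau> i\<close> is the last one at which the cursor is not below the threshold \<open>\<theta> i\<close>. Consecutive
    thresholds are farther apart than one step, so different thresholds have different cursors.\<close>
  define \<theta> where "\<theta> i = n + (int C + 1) * (int i + 1)" for i :: nat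
  define A where "A i = {l. l \<le> m \<and> \<theta> i \<le> cursor (u l)}" for i
  define \<tau> where "\<tau> i = Max (A i)" for i
  have finA: "finite (A i)" for i by (simp add: A_def)
  have \<theta>_le: "\<theta> i \<le> 2 * n - 2 * int C - 1" if "i \<le> N" for i
  proof -
    have "(int C + 1) * (int i + 1) \<le> (int C + 1) * (int N + 1)"
      using that by (intro mult_left_mono) auto
    then show ?thesis by (simp add: \<theta>_def n_def algebra_simps)
  qed
  have \<theta>_gt: "n < \<theta> i" for i by (simp add: \<theta>_def)
  have \<theta>_step: "\<theta> i + int C < \<theta> j" if "i < j" for i j
  proof -
    have "(int C + 1) * (int i + 2) \<le> (int C + 1) * (int j + 1)"
      using that by (intro mult_left_mono) auto
    then show ?thesis by (simp add: \<theta>_def algebra_simps)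
  qed
  have \<tau>: "l1 < \<tau> i" "\<tau> i < m" "\<theta> i \<le> cursor (u (\<tau> i))" "cursor (u (\<tau> i)) < \<theta> i + int C"
    if "i \<le> N" for i
  proof -
    have in_A: "Suc l1 \<in> A i"
      using far \<theta>_le[OF that] \<open>l1 < m\<close> by (simp add: A_def)
    then show "l1 < \<tau> i" using Max_ge[OF finA in_A] by (simp add: \<tau>_def)
    have "\<tau> i \<in> A i" unfolding \<tau>_def using in_A finA by (intro Max_in) auto
    then show cur: "\<theta> i \<le> cursor (u (\<tau> i))" and "\<tau> i < m"
      using um cursor_g \<theta>_gt[of i] by (auto simp: A_def order.order_iff_strict)
    then have "Suc (\<tau> i) \<notin> A i" using Max_ge[OF finA, of "Suc (\<tau> i)" i] by (auto simp: \<tau>_def)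
    then show "cursor (u (\<tau> i)) < \<theta> i + int C"
      using cstep[OF \<open>\<tau> i < m\<close>] \<open>\<tau> i < m\<close> by (simp add: A_def)
  qed
  have "\<not> inj_on (\<lambda>i. st (\<tau> i)) {0..N}"
  proof
    assume "inj_on (\<lambda>i. st (\<tau> i)) {0..N}"
    moreover have "(\<lambda>i. st (\<tau> i)) ` {0..N} \<subseteq> {1..N}"
      using st \<tau>(2) by fastforce
    ultimately show False using card_inj_on_le[of "\<lambda>i. st (\<tau> i)" "{0..N}" "{1..N}"] by simp
  qed
  then obtain i j where ij: "i < j" "j \<le> N" "st (\<tau> i) = st (\<tau> j)"
    unfolding inj_on_def by (metis atLeastAtMost_iff linorder_neqE_nat)
  \<comment> \<open>The higher threshold is passed first.\<close>
  define a b where "a = \<tau> j" and "b = \<tau> i"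
  have "A j \<subseteq> A i" using \<theta>_step[OF ij(1)] by (auto simp: A_def)
  moreover have "A j \<noteq> {}" using far \<theta>_le[OF ij(2)] \<open>l1 < m\<close> by (auto simp: A_def intro!: exI[of _ "Suc l1"])
  ultimately have "a \<le> b" unfolding a_def b_def \<tau>_def by (intro Max_mono finA)
  have "b < m" "st a = st b" using \<tau>(2)[of i] ij by (auto simp: a_def b_def)
  define p where "p = u a"
  define c where "c = - u a + u b"
  define q where "q = - u b + g"
  have "cursor c < 0"
    using \<tau>(3)[OF ij(2)] \<tau>(4)[of i] \<theta>_step[OF ij(1)] ij by (simp add: c_def a_def b_def)
  have y: "n < cursor p" "cursor p < 2 * n"
    using \<theta>_gt[of j] \<tau>(3,4)[OF ij(2)] \<theta>_le[OF ij(2)] by (auto simp: p_def a_def)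
  \<comment> \<open>Otherwise the path visits \<open>2 n\<close> before and \<open>- n\<close> after the time \<open>a\<close>, which takes at least
    \<open>7 n\<close> moves. But a path close to a geodesic has only \<open>5 n\<close> moves up to a bounded error.\<close>
  have "lamp p (- n) \<noteq> 0"
  proof
    assume dark: "lamp p (- n) = 0"
    have "lamp p (2 * n) \<noteq> 0"
      using lit[of a] \<tau>(1,2)[OF ij(2)] by (simp add: p_def a_def)
    then have 1: "4 * n - cursor p \<le> int (wreath_length p)"
      using wreath_length_ge_hull[of 0 p "2 * n"] y \<open>n > 0\<close> by simp
    have "lamp (- p + g) (- n - cursor p) \<noteq> 0"
      using dark x by (simp add: lamp_g)
    then have 2: "3 * n + cursor p \<le> int (wreath_length (- p + g))"
      using wreath_length_ge_hull[of "- n - cursor p" "- p + g" 0] y by (simp add: cursor_g)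
    have "wreath_length p + wreath_length (- p + g) \<le> wreath_length g + C"
      using pump[of a a 0] \<open>a \<le> b\<close> \<open>b < m\<close> by (simp add: p_def)
    with 1 2 len_g n_C show False by linarith
  qed
  then obtain D where D: "\<And>v. cursor v \<le> D \<Longrightarrow>
      int (wreath_length (p + v)) + 2 * n \<le> int (wreath_length p) + int (wreath_length v)"
    using detour_saved[of p n] y \<open>n > 0\<close> by auto
  define k where "k = nat \<bar>cursor q - D\<bar>"
  have "int k * cursor c \<le> int k * (- 1)"
    using \<open>cursor c < 0\<close> by (intro mult_left_mono) auto
  then have "cursor (((+) c ^^ k) q) \<le> D"
    unfolding cursor_funpow k_def by linarith
  from D[OF this] pump[OF \<open>a \<le> b\<close> \<open>b < m\<close> \<open>st a = st b\<close>, of k]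
  have "2 * n \<le> int C" unfolding p_def c_def q_def by linarith
  with n_C \<open>n > 0\<close> show False by linarith
qed

end
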